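(* Let $D$ be a set of cardinality $|D|>1$, let $0\notin D$, put $D^{\sim 0}=D\cup\{0\}$, and let $a\in D$ and $c\in D^{\sim 0}$ be different elements. Define binary operations on $D^{\sim 0}$ by $$x\dashv y=\begin{cases}a,&\text{if } x=y=a,\\ c,&\text{if } x=a\text{ and }y\ne a,\\ x,&\text{if } x\in D^{\sim 0}\setminus\{a\},\end{cases}\qquad x\vdash y=\begin{cases}y,&\text{if } x=a,\\ 0,&\text{if } x\in D^{\sim 0}\setminus\{a\}.\end{cases}$$ Then $(D^{\sim 0},\dashv,\vdash)$ is a nonabelian noncommutative dimonoid with $\mathrm{Halo}(D^{\sim 0},\dashv,\vdash)=\{a\}$ and $\mathrm{Aut}(D^{\sim 0},\dashv,\vdash)\cong S_{D^{\sim 0}\setminus\{a,c,0\}}$.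
   Context: A dimonoid is a set $D$ with two associative binary operations $\dashv,\vdash$ satisfying, for all $x,y,z\in D$: $(D_1)$ $(x\dashv y)\dashv z=x\dashv(y\vdash z)$; $(D_2)$ $(x\vdash y)\dashv z=x\vdash(y\dashv z)$; $(D_3)$ $(x\dashv y)\vdash z=x\vdash(y\vdash z)$. A dimonoid is commutative if both $\dashv$ and $\vdash$ are commutative (noncommutative means not commutative). It is abelian if $x\dashv y=y\vdash x$ for all $x,y$ (nonabelian means not abelian). $\mathrm{Halo}(D,\dashv,\vdash)$ is the set of bar-units, i.e. elements $e\in D$ with $e\vdash d=d=d\dashv e$ for all $d\in D$. $\mathrm{Aut}(D,\dashv,\vdash)$ is the group of bijections $D\to D$ preserving both operations. $S_X$ denotes the group of all permutations of the set $X$ (the trivial group if $X=\emptyset$). *)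

theory Defs
  imports "HOL-Algebra.Bij"
begin

locale dimonoid =
  fixes D :: "'a set"
    and lop :: "'a \<Rightarrow> 'a \<Rightarrow> 'a" (infixl "\<stileturn>" 70)
    and rop :: "'a \<Rightarrow> 'a \<Rightarrow> 'a" (infixl "\<turnstile>" 70)
  assumes lop_closed: "\<lbrakk>x \<in> D; y \<in> D\<rbrakk> \<Longrightarrow> x \<stileturn> y \<in> D"
    and rop_closed: "\<lbrakk>x \<in> D; y \<in> D\<rbrakk> \<Longrightarrow> x \<turnstile> y \<in> D"
    and lop_assoc: "\<lbrakk>x \<in> D; y \<in> D; z \<in> D\<rbrakk> \<Longrightarrow> (x \<stileturn> y) \<stileturn> z = x \<stileturn> (y \<stileturn> z)"
    and rop_assoc: "\<lbrakk>x \<in> D; y \<in> D; z \<in> D\<rbrakk> \<Longrightarrow> (x \<turnstile> y) \<turnstile> z = x \<turnstile> (y \<turnstile> z)"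
    and D1: "\<lbrakk>x \<in> D; y \<in> D; z \<in> D\<rbrakk> \<Longrightarrow> (x \<stileturn> y) \<stileturn> z = x \<stileturn> (y \<turnstile> z)"
    and D2: "\<lbrakk>x \<in> D; y \<in> D; z \<in> D\<rbrakk> \<Longrightarrow> (x \<turnstile> y) \<stileturn> z = x \<turnstile> (y \<stileturn> z)"
    and D3: "\<lbrakk>x \<in> D; y \<in> D; z \<in> D\<rbrakk> \<Longrightarrow> (x \<stileturn> y) \<turnstile> z = x \<turnstile> (y \<turnstile> z)"

definition dimonoid_commutative ::
    "'a set \<Rightarrow> ('a \<Rightarrow> 'a \<Rightarrow> 'a) \<Rightarrow> ('a \<Rightarrow> 'a \<Rightarrow> 'a) \<Rightarrow> bool" where
  "dimonoid_commutative D lop rop \<longleftrightarrow>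
     (\<forall>x\<in>D. \<forall>y\<in>D. lop x y = lop y x) \<and> (\<forall>x\<in>D. \<forall>y\<in>D. rop x y = rop y x)"

definition dimonoid_abelian ::
    "'a set \<Rightarrow> ('a \<Rightarrow> 'a \<Rightarrow> 'a) \<Rightarrow> ('a \<Rightarrow> 'a \<Rightarrow> 'a) \<Rightarrow> bool" where
  "dimonoid_abelian D lop rop \<longleftrightarrow> (\<forall>x\<in>D. \<forall>y\<in>D. lop x y = rop y x)"

definition dimonoid_halo ::
    "'a set \<Rightarrow> ('a \<Rightarrow> 'a \<Rightarrow> 'a) \<Rightarrow> ('a \<Rightarrow> 'a \<Rightarrow> 'a) \<Rightarrow> 'a set" where
  "dimonoid_halo D lop rop = {e \<in> D. \<forall>d\<in>D. rop e d = d \<and> lop d e = d}"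

text \<open>The group operation is that of \<^const>\<open>BijGroup\<close>, i.e. composition of the bijections
  of \<open>D\<close>, each represented by the function that is \<^const>\<open>undefined\<close> outside \<open>D\<close>.\<close>

definition dimonoid_Aut ::
    "'a set \<Rightarrow> ('a \<Rightarrow> 'a \<Rightarrow> 'a) \<Rightarrow> ('a \<Rightarrow> 'a \<Rightarrow> 'a) \<Rightarrow> ('a \<Rightarrow> 'a) monoid" where
  "dimonoid_Aut D lop rop = BijGroup D \<lparr>carrier :=
     {f \<in> Bij D. \<forall>x\<in>D. \<forall>y\<in>D. f (lop x y) = lop (f x) (f y) \<and> f (rop x y) = rop (f x) (f y)}\<rparr>"

lemma (in dimonoid) subgroup_Aut:
  "subgroup (carrier (dimonoid_Aut D lop rop)) (BijGroup D)"
proof -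
  let ?A = "carrier (dimonoid_Aut D lop rop)"
  have A: "?A = {f \<in> Bij D. \<forall>x\<in>D. \<forall>y\<in>D. f (x \<stileturn> y) = f x \<stileturn> f y \<and> f (x \<turnstile> y) = f x \<turnstile> f y}"
    by (simp add: dimonoid_Aut_def)
  interpret G: group "BijGroup D" by (rule group_BijGroup)
  show ?thesis
  proof (rule G.subgroupI)
    show "?A \<subseteq> carrier (BijGroup D)"
      by (auto simp: A BijGroup_def)
    have "(\<lambda>x\<in>D. x) \<in> ?A"
      by (auto simp: A id_Bij lop_closed rop_closed)
    then show "?A \<noteq> {}" by blast
  next
    fix f assume "f \<in> ?A"
    then have f: "f \<in> Bij D" and
      hom: "\<And>x y. \<lbrakk>x \<in> D; y \<in> D\<rbrakk> \<Longrightarrow> f (x \<stileturn> y) = f x \<stileturn> f y"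
        "\<And>x y. \<lbrakk>x \<in> D; y \<in> D\<rbrakk> \<Longrightarrow> f (x \<turnstile> y) = f x \<turnstile> f y"
      by (auto simp: A)
    let ?g = "\<lambda>x\<in>D. inv_into D f x"
    have bij: "inj_on f D" "f ` D = D"
      using f by (auto simp: Bij_def bij_betw_def)
    have "inv_into D f x \<in> D" "f (inv_into D f x) = x" if "x \<in> D" for x
      using bij that by (simp_all add: inv_into_into f_inv_into_f)
    then have "?g (x \<stileturn> y) = ?g x \<stileturn> ?g y \<and> ?g (x \<turnstile> y) = ?g x \<turnstile> ?g y"
      if "x \<in> D" "y \<in> D" for x y
      using that bij hom by (auto simp: lop_closed rop_closed intro!: inv_into_f_eq)
    then have "?g \<in> ?A"
      using f by (auto simp: A restrict_inv_into_Bij)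
    then show "inv\<^bsub>BijGroup D\<^esub> f \<in> ?A"
      using f by (simp add: inv_BijGroup)
  next
    fix f g assume "f \<in> ?A" "g \<in> ?A"
    moreover from this have "f \<in> Bij D" "g \<in> Bij D" by (auto simp: A)
    moreover from this have "g x \<in> D" if "x \<in> D" for x
      using that Bij_imp_funcset by blast
    ultimately show "f \<otimes>\<^bsub>BijGroup D\<^esub> g \<in> ?A"
      by (auto simp: A BijGroup_def compose_Bij compose_eq lop_closed rop_closed)
  qed
qed

lemma (in dimonoid) group_Aut: "group (dimonoid_Aut D lop rop)"
  using group.subgroup_imp_group[OF group_BijGroup subgroup_Aut]
  by (simp add: dimonoid_Aut_def)

end

(* The automorphisms turn out to be exactly the permutations fixing a, z and c: the bar-unit a
   is unique, z is the constant value of every product x |- y with x \<noteq> a, and c = a -| z.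
   Conversely both operations are defined in terms of a, c, z and equality with a alone. *)

theory Submission
  imports Defs
begin

text \<open>Restriction to \<open>E - S\<close> is the isomorphism: a bijection of \<open>E\<close>
  that fixes \<open>S\<close> pointwise maps the complement onto itself, and each bijection of the
  complement extends by the identity on \<open>S\<close>.\<close>

lemma BijGroup_pointwise_stabilizer_iso:
  assumes "S \<subseteq> E"
  shows "BijGroup E \<lparr>carrier := {f \<in> Bij E. \<forall>x\<in>S. f x = x}\<rparr> \<cong> BijGroup (E - S)"
proof -
  let ?C = "{f \<in> Bij E. \<forall>x\<in>S. f x = x}"
  let ?r = "\<lambda>f. restrict f (E - S)"
  have maps: "f ` (E - S) = E - S" if "f \<in> ?C" for f
  proof -
    from that have "inj_on f E" "f ` E = E" "f ` S = S"
      by (auto simp: Bij_def bij_betw_def)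
    then show ?thesis
      using assms inj_on_image_set_diff[of f E E S] by simp
  qed
  have r_Bij: "?r f \<in> Bij (E - S)" if "f \<in> ?C" for f
  proof -
    from that have "inj_on f (E - S)"
      by (auto simp: Bij_def bij_betw_def intro: inj_on_subset)
    with maps[OF that] show ?thesis
      by (auto simp: Bij_def bij_betw_def)
  qed
  \<comment> \<open>Since \<open>g\<close> maps \<open>E - S\<close> into itself, the outer
    \<open>f\<close> is evaluated only where it agrees with its restriction.\<close>
  have r_mult: "?r (compose E f g) = compose (E - S) (?r f) (?r g)"
    if "f \<in> ?C" "g \<in> ?C" for f g
    using maps[OF that(2)] by (auto simp: compose_def fun_eq_iff)
  have r_inj: "inj_on ?r ?C"
  proof (rule inj_onI)
    fix f g assume f: "f \<in> ?C" and g: "g \<in> ?C" and eq: "?r f = ?r g"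
    show "f = g"
    \<comment> \<open>On \<open>S\<close> both maps are the identity, on \<open>E - S\<close> they
      agree by \<open>eq\<close>, and outside \<open>E\<close> both are
      \<open>undefined\<close>.\<close>
    proof (rule extensionalityI[of _ E])
      show "f \<in> extensional E" "g \<in> extensional E"
        using f g by (auto simp: Bij_def)
      fix x assume "x \<in> E"
      then show "f x = g x"
        using f g fun_cong[OF eq, of x] by (cases "x \<in> S") auto
    qed
  qed
  have r_surj: "h \<in> ?r ` ?C" if h: "h \<in> Bij (E - S)" for h
  proof
    \<comment> \<open>The preimage of \<open>h\<close> is its extension by the identity on
      \<open>S\<close>, glued from bijections of the two disjoint pieces.\<close>
    let ?f = "\<lambda>x\<in>E. if x \<in> S then x else h x"
    have bij: "bij_betw h (E - S) (E - S)" and ext: "h \<in> extensional (E - S)"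
      using h by (auto simp: Bij_def)
    show "h = ?r ?f"
      using ext by (auto simp: fun_eq_iff extensional_def)
    have "bij_betw ?f (E - S) (E - S)"
      using bij by (rule bij_betw_cong[THEN iffD1, rotated]) auto
    moreover have "bij_betw ?f S S"
      using assms by (auto simp: bij_betw_def inj_on_def subset_iff image_iff)
    ultimately have "bij_betw ?f ((E - S) \<union> S) ((E - S) \<union> S)"
      by (rule bij_betw_combine) auto
    moreover have "(E - S) \<union> S = E"
      using assms by auto
    ultimately have "?f \<in> Bij E"
      by (simp add: Bij_def)
    then show "?f \<in> ?C"
      using assms by auto
  qed
  have "?r \<in> iso (BijGroup E \<lparr>carrier := ?C\<rparr>) (BijGroup (E - S))"
    using r_Bij r_mult r_inj r_surj
    by (auto simp: iso_def hom_def bij_betw_def BijGroup_def)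
  then show ?thesis
    by (auto simp: is_iso_def)
qed

theorem theorem3p2:
  fixes D :: "'a set" and z a c :: 'a
    and lop :: "'a \<Rightarrow> 'a \<Rightarrow> 'a" (infixl "\<stileturn>" 70)
    and rop :: "'a \<Rightarrow> 'a \<Rightarrow> 'a" (infixl "\<turnstile>" 70)
  assumes "infinite D \<or> card D > 1"
    and "z \<notin> D"
    and "a \<in> D" and "c \<in> D \<union> {z}" and "a \<noteq> c"
    and "\<And>x y. x \<in> D \<union> {z} \<Longrightarrow> y \<in> D \<union> {z} \<Longrightarrow>
           x \<stileturn> y = (if x = a \<and> y = a then a else if x = a \<and> y \<noteq> a then c else x)"
    and "\<And>x y. x \<in> D \<union> {z} \<Longrightarrow> y \<in> D \<union> {z} \<Longrightarrow>
           x \<turnstile> y = (if x = a then y else z)"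
  shows "dimonoid (D \<union> {z}) (\<stileturn>) (\<turnstile>)
    \<and> \<not> dimonoid_abelian (D \<union> {z}) (\<stileturn>) (\<turnstile>)
    \<and> \<not> dimonoid_commutative (D \<union> {z}) (\<stileturn>) (\<turnstile>)
    \<and> dimonoid_halo (D \<union> {z}) (\<stileturn>) (\<turnstile>) = {a}
    \<and> dimonoid_Aut (D \<union> {z}) (\<stileturn>) (\<turnstile>) \<cong> BijGroup ((D \<union> {z}) - {a, c, z})"
proof -
  let ?E = "D \<union> {z}"
  note lop = assms(6) and rop = assms(7)
  have za: "z \<noteq> a"
    using assms(2,3) by auto
  have aE: "a \<in> ?E" and cE: "c \<in> ?E" and zE: "z \<in> ?E"
    using assms(3,4) by auto
  \<comment> \<open>An element other than \<open>a\<close> and \<open>z\<close> refutes both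
    abelianness and commutativity: \<open>d \<turnstile> d = z\<close> while
    \<open>d \<stileturn> d = d\<close>, and \<open>z \<stileturn> d = z\<close> while
    \<open>d \<stileturn> z = d\<close>.\<close>
  obtain d where d: "d \<in> D" "d \<noteq> a"
  proof (rule ccontr)
    assume "\<not> thesis"
    then have "D = {a}"
      using that assms(3) by blast
    with assms(1) show False by simp
  qed
  then have dE: "d \<in> ?E" and dz: "d \<noteq> z"
    using assms(2) by auto

  have "dimonoid ?E (\<stileturn>) (\<turnstile>)"
  proof
    fix x y assume "x \<in> ?E" "y \<in> ?E"
    then show "x \<stileturn> y \<in> ?E" "x \<turnstile> y \<in> ?E"
      using aE cE zE by (simp_all only: lop rop split: if_split) auto
  next
    fix x y w assume "x \<in> ?E" "y \<in> ?E" "w \<in> ?E"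
    note E = this aE cE zE
    show "(x \<stileturn> y) \<stileturn> w = x \<stileturn> (y \<stileturn> w)"
      "(x \<turnstile> y) \<turnstile> w = x \<turnstile> (y \<turnstile> w)"
      "(x \<stileturn> y) \<stileturn> w = x \<stileturn> (y \<turnstile> w)"
      "(x \<turnstile> y) \<stileturn> w = x \<turnstile> (y \<stileturn> w)"
      "(x \<stileturn> y) \<turnstile> w = x \<turnstile> (y \<turnstile> w)"
      \<comment> \<open>The operations only test equality with \<open>a\<close>, and neither
        \<open>c\<close> nor \<open>z\<close> equals \<open>a\<close>, so three case splits decide
        every branch. The deleted simp rules keep membership in \<open>D \<union> {z}\<close> in the
        form that the premises of \<open>lop\<close> and \<open>rop\<close> have.\<close>
      using E za assms(5)
      by (cases "x = a"; cases "y = a"; cases "w = a";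
          simp del: Un_iff Un_insert_right add: lop rop)+
  qed
  moreover have "\<not> dimonoid_abelian ?E (\<stileturn>) (\<turnstile>)"
  proof
    assume "dimonoid_abelian ?E (\<stileturn>) (\<turnstile>)"
    then have "d \<stileturn> d = d \<turnstile> d"
      using dE by (auto simp: dimonoid_abelian_def)
    then show False
      using d dz by (simp add: lop[OF dE dE] rop[OF dE dE])
  qed
  moreover have "\<not> dimonoid_commutative ?E (\<stileturn>) (\<turnstile>)"
  proof
    assume "dimonoid_commutative ?E (\<stileturn>) (\<turnstile>)"
    then have "d \<stileturn> z = z \<stileturn> d"
      using dE by (auto simp: dimonoid_commutative_def)
    then show False
      using d dz za by (simp add: lop[OF dE zE] lop[OF zE dE])
  qed
  moreover have halo: "dimonoid_halo ?E (\<stileturn>) (\<turnstile>) = {a}"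
  proof -
    have "e = a" if "e \<in> ?E" "\<forall>x\<in>?E. e \<turnstile> x = x \<and> x \<stileturn> e = x" for e
    proof (rule ccontr)
      assume "e \<noteq> a"
      then have "e \<turnstile> a = z"
        using rop[OF that(1) aE] by simp
      with that(2) aE za show False by auto
    qed
    moreover have "\<forall>x\<in>?E. a \<turnstile> x = x \<and> x \<stileturn> a = x"
    proof
      fix x assume "x \<in> ?E"
      then show "a \<turnstile> x = x \<and> x \<stileturn> a = x"
        using lop[OF _ aE, of x] rop[OF aE, of x] by simp
    qed
    ultimately show ?thesis
      using aE unfolding dimonoid_halo_def by blast
  qed
  moreover have "dimonoid_Aut ?E (\<stileturn>) (\<turnstile>) \<cong> BijGroup (?E - {a, c, z})"
  proof -
    have "(\<forall>x\<in>?E. \<forall>y\<in>?E. f (x \<stileturn> y) = f x \<stileturn> f y \<and> f (x \<turnstile> y) = f x \<turnstile> f y)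
        \<longleftrightarrow> (\<forall>x\<in>{a, c, z}. f x = x)" (is "?hom \<longleftrightarrow> ?fix") if "f \<in> Bij ?E" for f
    proof
      from that have inj: "inj_on f ?E" and surj: "f ` ?E = ?E"
        by (auto simp: Bij_def bij_betw_def)
      have fE: "f x \<in> ?E" if "x \<in> ?E" for x
        using surj that by blast
      {
        assume ?hom
        then have hom: "f (x \<stileturn> y) = f x \<stileturn> f y" "f (x \<turnstile> y) = f x \<turnstile> f y"
          if "x \<in> ?E" "y \<in> ?E" for x y
          using that by blast+
        have unit: "a \<turnstile> x = x \<and> x \<stileturn> a = x" if "x \<in> ?E" for x
          using halo that unfolding dimonoid_halo_def by blast
        \<comment> \<open>By surjectivity every \<open>y\<close> is some \<open>f x\<close>, so
          \<open>f\<close> carries the bar-unit \<open>a\<close> to a bar-unit.\<close>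
        have "f a \<turnstile> y = y \<and> y \<stileturn> f a = y" if "y \<in> ?E" for y
        proof -
          from that surj obtain x where x: "x \<in> ?E" "y = f x" by blast
          then show ?thesis
            using hom[OF aE x(1)] hom[OF x(1) aE] unit[OF x(1)] by simp
        qed
        then have "f a \<in> dimonoid_halo ?E (\<stileturn>) (\<turnstile>)"
          using fE[OF aE] by (simp add: dimonoid_halo_def)
        with halo have fa: "f a = a" by simp
        then have "f z \<noteq> a"
          using inj_onD[OF inj _ zE aE] za by metis
        \<comment> \<open>Apply \<open>f\<close> to \<open>z \<turnstile> z = z\<close>: since
          \<open>f z \<noteq> a\<close>, the product \<open>f z \<turnstile> f z\<close> is
          \<open>z\<close>.\<close>
        then have fz: "f z = z"
          using hom(2)[OF zE zE] za rop[OF zE zE] rop[OF fE[OF zE] fE[OF zE]] by simp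
        have "f c = c"
          using hom(1)[OF aE zE] lop[OF aE zE] za fa fz by simp
        with fa fz show ?fix by simp
      next
        assume ?fix
        then have fa: "f a = a" and fc: "f c = c" and fz: "f z = z" by auto
        \<comment> \<open>Injectivity together with \<open>f a = a\<close> makes \<open>f\<close>
          respect the test on which both operations branch.\<close>
        have eq_a: "f x = a \<longleftrightarrow> x = a" if "x \<in> ?E" for x
          using inj_onD[OF inj _ that aE] fa by metis
        show ?hom
        proof (intro ballI)
          fix x y assume x: "x \<in> ?E" and y: "y \<in> ?E"
          show "f (x \<stileturn> y) = f x \<stileturn> f y \<and> f (x \<turnstile> y) = f x \<turnstile> f y"
            using lop[OF x y] rop[OF x y] lop[OF fE[OF x] fE[OF y]] rop[OF fE[OF x] fE[OF y]]
              eq_a[OF x] eq_a[OF y] fa fc fz by simp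
        qed
      }
    qed
    then have "dimonoid_Aut ?E (\<stileturn>) (\<turnstile>)
        = BijGroup ?E \<lparr>carrier := {f \<in> Bij ?E. \<forall>x\<in>{a, c, z}. f x = x}\<rparr>"
      \<comment> \<open>The equivalence holds only for bijections; \<open>conj_cong\<close> supplies
        \<open>f \<in> Bij ?E\<close> while the second conjunct is rewritten.\<close>
      unfolding dimonoid_Aut_def by (simp cong: conj_cong)
    \<comment> \<open>The case \<open>c = z\<close> is allowed; it needs no separate treatment
      because the fixed points enter only as a set.\<close>
    then show ?thesis
      using BijGroup_pointwise_stabilizer_iso[of "{a, c, z}" ?E] aE cE zE by simp
  qed
  ultimately show ?thesis by blast
qed

end
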